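(* Let $\Phi$ be a measurable function on $\mathbb{R}^n$ and let $A:\mathbb{R}^n\to GL(d,\mathbb{R})$ be a measurable map, where $A(y)$ has singular values $\{\lambda_j(y)\}_{j=1}^d$. For $f\in\mathcal{S}(\mathbb{R}^d)$ consider the map $$T_f:\ g\mapsto\int_{\mathbb{R}^d}\int_{\mathbb{R}^n}\Phi(y)f(A(y)x)\overline{g(x)}\,dy\,dx,\qquad g\in\mathcal{S}(\mathbb{R}^d).$$ If $$\int_{\mathbb{R}^n}|\Phi(y)|\prod_{j=1}^d\bigl(1\wedge\lambda_j(y)^{-1}\bigr)\,dy<\infty,\qquad(\ast)$$ then $T_f$ belongs to $\mathcal{S}'(\mathbb{R}^d)$ for every $f\in\mathcal{S}(\mathbb{R}^d)$, and hence the Hausdorff operator $H_{\Phi,A}:f\mapsto T_f$ is defined as a map from $\mathcal{S}(\mathbb{R}^d)$ into $\mathcal{S}'(\mathbb{R}^d)$. Conversely, if $\Phi$ is nonnegative and $T_f$ is well defined and belongs to $\mathcal{S}'(\mathbb{R}^d)$ for every $f\in\mathcal{S}(\mathbb{R}^d)$, then $(\ast)$ holds.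
   Context: $a\wedge b=\min\{a,b\}$. Singular values of $A(y)$ are the eigenvalues of $\sqrt{A(y)^TA(y)}$ with multiplicity. $T_f$ being well defined means that the integral is (absolutely) convergent for all $g\in\mathcal{S}(\mathbb{R}^d)$. Elements of $\mathcal{S}'(\mathbb{R}^d)$ are paired with $\mathcal{S}(\mathbb{R}^d)$ through the extension of the complex $L^2$ inner product, so they are regarded as continuous functionals that are conjugate-linear in $g$. *)

theory Defs
  imports "HOL-Analysis.Analysis"
begin

definition partial_deriv ::
    "'d::finite \<Rightarrow> (real^'d \<Rightarrow> complex) \<Rightarrow> real^'d \<Rightarrow> complex" where
  "partial_deriv i f x = frechet_derivative f (at x) (axis i 1)"

text \<open>Iterated partial derivatives are indexed by lists of coordinates, so every order of
  differentiation is covered; on smooth functions the order is irrelevant and a list amounts to a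
  multi-index.\<close>

definition partial_derivs ::
    "'d::finite list \<Rightarrow> (real^'d \<Rightarrow> complex) \<Rightarrow> real^'d \<Rightarrow> complex" where
  "partial_derivs is f = foldr partial_deriv is f"

definition smooth :: "(real^'d::finite \<Rightarrow> complex) \<Rightarrow> bool" where
  "smooth f \<longleftrightarrow> (\<forall>is x. partial_derivs is f differentiable (at x))"

text \<open>The function \<open>x \<mapsto> x\<^sup>\<alpha> \<partial>\<^sup>\<beta> f(x)\<close>.\<close>

definition weighted_deriv ::
    "('d::finite \<Rightarrow> nat) \<Rightarrow> 'd list \<Rightarrow> (real^'d \<Rightarrow> complex) \<Rightarrow> real^'d \<Rightarrow> complex" where
  "weighted_deriv \<alpha> is f x = (\<Prod>i\<in>UNIV. (x $ i) ^ \<alpha> i) *\<^sub>R partial_derivs is f x"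

definition schwartz :: "(real^'d::finite \<Rightarrow> complex) set" where
  "schwartz = {f. smooth f \<and> (\<forall>\<alpha> is. bounded (range (weighted_deriv \<alpha> is f)))}"

definition schwartz_seminorm ::
    "('d::finite \<Rightarrow> nat) \<Rightarrow> 'd list \<Rightarrow> (real^'d \<Rightarrow> complex) \<Rightarrow> real" where
  "schwartz_seminorm \<alpha> is f = (SUP x. norm (weighted_deriv \<alpha> is f x))"

definition schwartz_topology :: "(real^'d::finite \<Rightarrow> complex) topology" where
  "schwartz_topology = topology_generated_by
     {{g \<in> schwartz. schwartz_seminorm \<alpha> is (\<lambda>x. g x - h x) < e} | \<alpha> is h e. h \<in> schwartz \<and> 0 < e}"

text \<open>Tempered distributions are paired with Schwartz functions through the complex inner product,
  hence are conjugate-linear. Only the values of \<open>u\<close> on \<open>schwartz\<close> matter.\<close>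

definition tempered_distributions :: "((real^'d::finite \<Rightarrow> complex) \<Rightarrow> complex) set" where
  "tempered_distributions = {u.
     (\<forall>g\<in>schwartz. \<forall>h\<in>schwartz. u (\<lambda>x. g x + h x) = u g + u h) \<and>
     (\<forall>c. \<forall>g\<in>schwartz. u (\<lambda>x. c * g x) = cnj c * u g) \<and>
     continuous_map schwartz_topology euclidean u}"

definition positive_semidefinite :: "real^'d^'d::finite \<Rightarrow> bool" where
  "positive_semidefinite B \<longleftrightarrow> transpose B = B \<and> (\<forall>x. 0 \<le> x \<bullet> (B *v x))"

text \<open>\<open>s\<close> lists the eigenvalues of \<open>B\<close>, each repeated according to its multiplicity, for \<open>B\<close>
  symmetric (where geometric and algebraic multiplicity agree). A number that is not an eigenvalue
  has eigenspace of dimension 0 and so does not occur in the list.\<close>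

definition lists_eigenvalues :: "real^'d^'d::finite \<Rightarrow> ('d \<Rightarrow> real) \<Rightarrow> bool" where
  "lists_eigenvalues B s \<longleftrightarrow> (\<forall>t. card {j. s j = t} = dim {v. B *v v = t *\<^sub>R v})"

text \<open>\<open>s\<close> lists the singular values of \<open>M\<close>: the matrix \<open>B\<close> is the unique positive semidefinite
  square root of \<open>M\<^sup>T M\<close>.\<close>

definition lists_singular_values :: "real^'d^'d::finite \<Rightarrow> ('d \<Rightarrow> real) \<Rightarrow> bool" where
  "lists_singular_values M s \<longleftrightarrow>
     (\<exists>B. positive_semidefinite B \<and> B ** B = transpose M ** M \<and> lists_eigenvalues B s)"

text \<open>The functional \<open>T\<^sub>f\<close> is \<open>hausdorff_operator \<Phi> A f\<close>. The Bochner integral returns 0 where it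
  does not converge, so absolute convergence is a separate predicate; joint integrability is, by
  Tonelli, absolute convergence of the iterated integral.\<close>

definition hausdorff_operator ::
    "(real^'n::finite \<Rightarrow> complex) \<Rightarrow> (real^'n \<Rightarrow> real^'d^'d::finite) \<Rightarrow>
     (real^'d \<Rightarrow> complex) \<Rightarrow> (real^'d \<Rightarrow> complex) \<Rightarrow> complex" where
  "hausdorff_operator \<Phi> A f g =
     (LINT x|lebesgue. (LINT y|lebesgue. \<Phi> y * f (A y *v x) * cnj (g x)))"

definition hausdorff_well_defined ::
    "(real^'n::finite \<Rightarrow> complex) \<Rightarrow> (real^'n \<Rightarrow> real^'d^'d::finite) \<Rightarrow>
     (real^'d \<Rightarrow> complex) \<Rightarrow> bool" where
  "hausdorff_well_defined \<Phi> A f \<longleftrightarrow> (\<forall>g\<in>schwartz.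
     integrable (lebesgue \<Otimes>\<^sub>M lebesgue) (\<lambda>(x, y). \<Phi> y * f (A y *v x) * cnj (g x)))"

end

theory Submission
  imports Defs
begin

text \<open>Write \<open>P y\<close> for the product of the numbers \<open>min 1 (1 / s y j)\<close>. For a weight \<open>w\<close> on
  \<open>\<real>\<^sup>d\<close> consider the kernel \<open>W y = \<integral> w (A y x) w x dx\<close>. By Tonelli, absolute convergence of the
  double integral with \<open>w\<close> in both places means that \<open>\<bar>\<Phi>\<bar> W\<close> is integrable. The theorem follows
  from two weights whose kernels are comparable to \<open>P\<close>, one from above and one from below.

  The link between \<open>W\<close> and the singular values is that, in coordinates along an orthonormal
  eigenbasis of the positive square root of \<open>A\<^sup>T A\<close>, the norm of \<open>A x\<close> squared is \<open>\<Sum> s\<^sub>j\<^sup>2 z\<^sub>j\<^sup>2\<close>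
  while the norm of \<open>x\<close> squared stays \<open>\<Sum> z\<^sub>j\<^sup>2\<close>. Lebesgue measure is invariant under this rotation,
  so for weights that are functions of the norm, \<open>W\<close> can be compared with a product of integrals
  over the line (\<open>nn_integral_principal_axes\<close>). Each factor is of the order of \<open>min 1 (1 / s\<^sub>j)\<close>,
  because its integrand is concentrated where both \<open>\<bar>t\<bar> \<le> 1\<close> and \<open>\<bar>s\<^sub>j t\<bar> \<le> 1\<close>.

  Sufficiency. Take the weight \<open>decay x = (1 + \<bar>x\<bar>\<^sup>2)\<^sup>-\<^sup>d\<close>. It is dominated by
  \<open>\<Prod> (1 + x\<^sub>j\<^sup>2)\<^sup>-\<^sup>1\<close>, so \<open>W \<le> \<pi>\<^sup>d P\<close> (\<open>decay_kernel_le\<close>). Every Schwartz function is bounded by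
  \<open>decay\<close> times a finite sum of Schwartz seminorms of order zero. Hence the double integral converges
  absolutely, and its value depends on \<open>g\<close> with a bound by finitely many seminorms of \<open>g\<close>, which is
  continuity (\<open>hausdorff_operator_tempered\<close>).

  Necessity. Take \<open>f = g\<close> to be the Gaussian. Its kernel factors exactly and is at least
  \<open>e\<^sup>-\<^sup>2\<^sup>d P\<close> (\<open>gaussian_kernel_ge\<close>), so absolute convergence for this one pair already gives the
  condition on \<open>\<Phi>\<close> (\<open>hausdorff_condition_necessary\<close>).\<close>

section \<open>Singular values and principal axes\<close>

lemma symmetric_matrix_inner_commute:
  fixes B :: "real^'d::finite^'d"
  assumes "transpose B = B"
  shows "(B *v x) \<bullet> y = x \<bullet> (B *v y)"
  by (metis assms dot_lmul_matrix inner_commute transpose_matrix_vector)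

text \<open>The list has one entry for each coordinate, so the dimensions of the eigenspaces add up to the
  full dimension. Eigenspaces of a symmetric matrix for different eigenvalues are orthogonal, and
  therefore orthonormal bases of all of them fit together. The spectral theorem is thus already
  contained in the hypothesis that the eigenvalues can be listed.\<close>

lemma lists_eigenvalues_imp_orthonormal_eigenbasis:
  fixes B :: "real^'d::finite^'d"
  assumes sym: "transpose B = B" and ev: "lists_eigenvalues B s"
  obtains v where "\<And>i j. v i \<bullet> v j = (if i = j then 1 else 0)"
    and "\<And>j. B *v v j = s j *\<^sub>R v j"
proof -
  let ?E = "\<lambda>t. {v. B *v v = t *\<^sub>R v}"
  \<comment> \<open>An orthonormal basis of each eigenspace, indexed by the entries of the list equal to that
    eigenvalue; for a number that is not an eigenvalue both the index set and the basis are empty.\<close>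
  have "\<forall>t. \<exists>h. inj_on h {j. s j = t} \<and> h ` {j. s j = t} \<subseteq> ?E t \<and>
          pairwise orthogonal (h ` {j. s j = t}) \<and> (\<forall>x\<in>h ` {j. s j = t}. norm x = 1)"
  proof
    fix t
    have "subspace (?E t)"
      by (auto simp: subspace_def matrix_vector_right_distrib algebra_simps
          matrix_vector_mult_scaleR)
    then obtain X where X: "X \<subseteq> ?E t" "pairwise orthogonal X" "\<And>x. x \<in> X \<Longrightarrow> norm x = 1"
        "independent X" "card X = dim (?E t)"
      by (rule orthonormal_basis_subspace) blast
    have "card X = card {j. s j = t}" "finite X"
      using ev X(4,5) by (auto simp: lists_eigenvalues_def independent_imp_finite)
    then obtain h where "bij_betw h {j. s j = t} X"
      using finite_same_card_bij[of "{j. s j = t}" X] by auto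
    then show "\<exists>h. inj_on h {j. s j = t} \<and> h ` {j. s j = t} \<subseteq> ?E t \<and>
        pairwise orthogonal (h ` {j. s j = t}) \<and> (\<forall>x\<in>h ` {j. s j = t}. norm x = 1)"
      using X by (auto simp: bij_betw_def)
  qed
  from choice[OF this] obtain h where h: "\<And>t. inj_on (h t) {j. s j = t}" "\<And>t. h t ` {j. s j = t} \<subseteq> ?E t"
      "\<And>t. pairwise orthogonal (h t ` {j. s j = t})" "\<And>t x. x \<in> h t ` {j. s j = t} \<Longrightarrow> norm x = 1"
    by blast
  define v where "v j = h (s j) j" for j
  have eig: "B *v v j = s j *\<^sub>R v j" for j
    using h(2)[of "s j"] by (auto simp: v_def)
  have "norm (v j) = 1" for j
    using h(4)[of "v j" "s j"] by (auto simp: v_def)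
  then have unit: "v j \<bullet> v j = 1" for j
    by (simp add: norm_eq_1)
  have "v i \<bullet> v j = 0" if "i \<noteq> j" for i j
  proof (cases "s i = s j")
    case True
    then have "v i \<noteq> v j"
      using that h(1)[of "s j"] by (auto simp: v_def inj_on_def)
    moreover have "v i \<in> h (s j) ` {k. s k = s j}" "v j \<in> h (s j) ` {k. s k = s j}"
      using True by (auto simp: v_def)
    ultimately show ?thesis
      using h(3)[of "s j"] by (auto simp: pairwise_def orthogonal_def)
  next
    case False
    then show ?thesis
      using symmetric_matrix_inner_commute[OF sym, of "v i" "v j"] by (simp add: eig)
  qed
  with unit eig that show thesis
    by (intro that[of v]) auto
qed

text \<open>The part of the singular value decomposition that concerns norms: the left orthogonal factor
  does not change the norm of \<open>M x\<close>, hence \<open>M\<close> may be replaced by the square root \<open>B\<close> of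
  \<open>M\<^sup>T M\<close>, which is diagonal in its eigenbasis.\<close>

lemma lists_singular_values_imp_principal_axes:
  fixes M :: "real^'d::finite^'d"
  assumes "lists_singular_values M s"
  obtains Q where "orthogonal_transformation Q"
    and "\<And>z. (norm (M *v Q z))\<^sup>2 = (\<Sum>j\<in>UNIV. (s j)\<^sup>2 * (z $ j)\<^sup>2)"
    and "\<And>j. 0 \<le> s j"
proof -
  obtain B where B: "transpose B = B" "\<And>x. 0 \<le> x \<bullet> (B *v x)"
      "B ** B = transpose M ** M" "lists_eigenvalues B s"
    using assms by (auto simp: lists_singular_values_def positive_semidefinite_def)
  obtain v where orth: "\<And>i j. v i \<bullet> v j = (if i = j then 1 else 0)"
      and eig: "\<And>j. B *v v j = s j *\<^sub>R v j"
    using lists_eigenvalues_imp_orthonormal_eigenbasis[OF B(1,4)] by blast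
  \<comment> \<open>The orthogonal map that sends the coordinate axes to the eigenvectors of \<open>B\<close>.\<close>
  define Q where "Q z = (\<Sum>j\<in>UNIV. (z $ j) *\<^sub>R v j)" for z :: "real^'d"
  have lin: "linear Q"
    by (rule linearI) (simp_all add: Q_def scaleR_left_distrib sum.distrib scaleR_sum_right)
  have comb: "(\<Sum>j\<in>UNIV. a j *\<^sub>R v j) \<bullet> (\<Sum>j\<in>UNIV. b j *\<^sub>R v j) = (\<Sum>j\<in>UNIV. a j * b j)" for a b
    by (simp add: inner_sum_left inner_sum_right orth if_distrib mult.commute cong: if_cong)
  have "orthogonal_transformation Q"
    unfolding orthogonal_transformation_def
    using lin comb by (simp add: Q_def inner_vec_def)
  moreover have "(norm (M *v Q z))\<^sup>2 = (\<Sum>j\<in>UNIV. (s j)\<^sup>2 * (z $ j)\<^sup>2)" for z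
  proof -
    have "(norm (M *v Q z))\<^sup>2 = Q z \<bullet> ((B ** B) *v Q z)"
      by (simp add: B(3) power2_norm_eq_inner flip: matrix_vector_mul_assoc)
        (metis dot_lmul_matrix inner_commute transpose_matrix_vector)
    also have "\<dots> = (B *v Q z) \<bullet> (B *v Q z)"
      by (simp add: symmetric_matrix_inner_commute[OF B(1)] flip: matrix_vector_mul_assoc)
    also have "B *v Q z = (\<Sum>j\<in>UNIV. (z $ j * s j) *\<^sub>R v j)"
      by (simp add: Q_def linear_sum[OF matrix_vector_mul_linear] matrix_vector_mult_scaleR eig)
    also have "\<dots> \<bullet> \<dots> = (\<Sum>j\<in>UNIV. (s j)\<^sup>2 * (z $ j)\<^sup>2)"
      unfolding comb by (simp add: power2_eq_square algebra_simps)
    finally show ?thesis .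
  qed
  moreover have "0 \<le> s j" for j
    using B(2)[of "v j"] by (simp add: eig orth)
  ultimately show thesis
    by (rule that)
qed

text \<open>The norm of \<open>M\<close> on the \<open>j\<close>-th principal axis is \<open>s j\<close>.\<close>

lemma singular_values_invertible_pos:
  fixes M :: "real^'d::finite^'d"
  assumes "lists_singular_values M s" "invertible M"
  shows "0 < s j"
proof -
  obtain Q where Q: "orthogonal_transformation Q"
      "\<And>z. (norm (M *v Q z))\<^sup>2 = (\<Sum>j\<in>UNIV. (s j)\<^sup>2 * (z $ j)\<^sup>2)" "\<And>j. 0 \<le> s j"
    using lists_singular_values_imp_principal_axes[OF assms(1)] by blast
  have "norm (Q (axis j 1)) = 1"
    using Q(1) by (simp add: orthogonal_transformation_norm norm_axis_1)
  then have "Q (axis j 1) \<noteq> 0"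
    by auto
  moreover have "inj ((*v) M)"
    using assms(2) by (simp add: inj_matrix_vector_mult)
  ultimately have "M *v Q (axis j 1) \<noteq> 0"
    by (metis injD matrix_vector_mult_0_right)
  moreover have "(norm (M *v Q (axis j 1)))\<^sup>2 = (s j)\<^sup>2"
    unfolding Q(2) by (simp add: axis_def if_distrib[of "\<lambda>x. x\<^sup>2"] if_distrib[of "(*) _"] cong: if_cong)
  ultimately show ?thesis
    using Q(3)[of j] by (auto simp: less_le)
qed

section \<open>Lebesgue measure in rotated coordinates\<close>

lemma nn_integral_lborel_shift:
  fixes h :: "'a::euclidean_space \<Rightarrow> ennreal"
  assumes [measurable]: "h \<in> borel_measurable borel"
  shows "(\<integral>\<^sup>+x. h (a + x) \<partial>lborel) = (\<integral>\<^sup>+x. h x \<partial>lborel)"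
proof -
  have "(\<integral>\<^sup>+x. h x \<partial>lborel) = (\<integral>\<^sup>+x. h x \<partial>distr lborel borel ((+) a))"
    by (simp add: lborel_distr_plus)
  then show ?thesis
    by (simp add: nn_integral_distr)
qed

text \<open>Uniqueness of Haar measure in miniature. Both integrals are invariant under translation of
  \<open>h\<close>. Let \<open>g\<close> be the indicator of the unit ball and \<open>c\<close> its volume. Integrating
  \<open>g y * h (T x + y)\<close> over \<open>x\<close> first gives \<open>c\<close> times the left side. Integrating it over \<open>y\<close>
  first, after the substitution \<open>y \<mapsto> y - T x\<close>, gives \<open>c\<close> times the right side, since the ball is
  invariant under \<open>T\<close>. As \<open>0 < c < \<infinity>\<close>, it can be cancelled.\<close>

lemma nn_integral_lborel_orthogonal_transformation:
  fixes T :: "'a::euclidean_space \<Rightarrow> 'a"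
  assumes T: "orthogonal_transformation T" and [measurable]: "h \<in> borel_measurable borel"
  shows "(\<integral>\<^sup>+x. h (T x) \<partial>lborel) = (\<integral>\<^sup>+x. h x \<partial>lborel)"
proof -
  define g :: "'a \<Rightarrow> ennreal" where "g = indicator (ball 0 1)"
  define c where "c = (\<integral>\<^sup>+x. g x \<partial>lborel)"
  have [measurable]: "g \<in> borel_measurable borel"
    unfolding g_def by (intro borel_measurable_indicator) simp
  have c: "c \<noteq> 0" "c \<noteq> \<infinity>"
    using emeasure_lborel_ball_finite[of "0::'a" 1] content_ball_pos[of 1 "0::'a"]
    by (auto simp: c_def g_def measure_def)
  have lin: "linear T"
    using T by (rule orthogonal_transformation_linear)
  have [measurable]: "T \<in> borel_measurable borel"
    using lin by (intro borel_measurable_continuous_onI linear_continuous_on)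
      (simp add: linear_conv_bounded_linear)
  have T_inv: "T (inv T y) = y" for y
    using T by (simp add: orthogonal_transformation_surj surj_f_inv_f)
  have "c * (\<integral>\<^sup>+x. h (T x) \<partial>lborel) = (\<integral>\<^sup>+y. g y * (\<integral>\<^sup>+x. h (T x) \<partial>lborel) \<partial>lborel)"
    by (simp add: c_def nn_integral_multc)
  \<comment> \<open>The inner integral is unchanged when \<open>x\<close> is shifted by \<open>inv T y\<close>.\<close>
  also have "\<dots> = (\<integral>\<^sup>+y. \<integral>\<^sup>+x. g y * h (T x + y) \<partial>lborel \<partial>lborel)"
  proof (rule nn_integral_cong)
    fix y
    have "(\<integral>\<^sup>+x. h (T x) \<partial>lborel) = (\<integral>\<^sup>+x. h (T (inv T y + x)) \<partial>lborel)"
      by (rule nn_integral_lborel_shift[symmetric]) measurable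
    also have "\<dots> = (\<integral>\<^sup>+x. h (T x + y) \<partial>lborel)"
      by (simp add: linear_add[OF lin] T_inv add.commute)
    finally show "g y * (\<integral>\<^sup>+x. h (T x) \<partial>lborel) = (\<integral>\<^sup>+x. g y * h (T x + y) \<partial>lborel)"
      by (simp add: nn_integral_cmult)
  qed
  also have "\<dots> = (\<integral>\<^sup>+x. \<integral>\<^sup>+y. g y * h (T x + y) \<partial>lborel \<partial>lborel)"
    by (rule lborel_pair.Fubini') simp
  also have "\<dots> = (\<integral>\<^sup>+x. \<integral>\<^sup>+y. g (y - T x) * h y \<partial>lborel \<partial>lborel)"
  proof (rule nn_integral_cong)
    fix x
    show "(\<integral>\<^sup>+y. g y * h (T x + y) \<partial>lborel) = (\<integral>\<^sup>+y. g (y - T x) * h y \<partial>lborel)"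
      using nn_integral_lborel_shift[of "\<lambda>y. g (y - T x) * h y" "T x"] by simp
  qed
  also have "\<dots> = (\<integral>\<^sup>+y. \<integral>\<^sup>+x. g (y - T x) * h y \<partial>lborel \<partial>lborel)"
    by (rule lborel_pair.Fubini') simp
  also have "\<dots> = (\<integral>\<^sup>+y. c * h y \<partial>lborel)"
  proof (rule nn_integral_cong)
    fix y
    \<comment> \<open>\<open>T\<close> preserves the norm, on which alone \<open>g\<close> depends.\<close>
    have "g (y - T x) = g (- inv T y + x)" for x
    proof -
      have "y - T x = T (inv T y - x)"
        by (simp add: linear_diff[OF lin] T_inv)
      then have "norm (y - T x) = norm (inv T y - x)"
        using T by (simp add: orthogonal_transformation_norm)
      then show ?thesis
        by (simp add: g_def indicator_def norm_minus_commute)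
    qed
    then have "(\<integral>\<^sup>+x. g (y - T x) \<partial>lborel) = c"
      unfolding c_def by (simp only: nn_integral_lborel_shift \<open>g \<in> borel_measurable borel\<close>)
    then show "(\<integral>\<^sup>+x. g (y - T x) * h y \<partial>lborel) = c * h y"
      by (simp add: nn_integral_multc)
  qed
  also have "\<dots> = c * (\<integral>\<^sup>+y. h y \<partial>lborel)"
    by (simp add: nn_integral_cmult)
  finally show ?thesis
    using c by (simp add: ennreal_mult_cancel_left top_unique)
qed

lemma nn_integral_lborel_vec_prod:
  fixes h :: "'d::finite \<Rightarrow> real \<Rightarrow> ennreal"
  assumes "\<And>j. h j \<in> borel_measurable borel"
  shows "(\<integral>\<^sup>+z. (\<Prod>j\<in>UNIV. h j ((z::real^'d) $ j)) \<partial>lborel) = (\<Prod>j\<in>UNIV. \<integral>\<^sup>+t. h j t \<partial>lborel)"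
proof -
  \<comment> \<open>Recovers the coordinate from a standard basis vector.\<close>
  let ?ix = "\<lambda>b::real^'d. SOME j. b = axis j 1"
  have ix: "?ix (axis j 1) = j" for j
    by (rule some_equality) (auto simp: axis_eq_axis)
  have bij: "bij_betw (\<lambda>j. axis j 1) UNIV (Basis :: (real^'d) set)"
    by (auto simp: bij_betw_def inj_on_def axis_eq_axis Basis_vec_def)
  have "(\<integral>\<^sup>+z. (\<Prod>b\<in>Basis. h (?ix b) (z \<bullet> b)) \<partial>lborel) = (\<Prod>b\<in>Basis. \<integral>\<^sup>+t. h (?ix b) t \<partial>lborel)"
    using assms by (intro nn_integral_lborel_prod) auto
  then show ?thesis
    by (simp add: prod.reindex_bij_betw[OF bij, symmetric] ix inner_axis)
qed

text \<open>Integrals that involve \<open>x\<close> only through the norms of \<open>x\<close> and \<open>M x\<close> depend on \<open>M\<close> only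
  through its singular values.\<close>

lemma nn_integral_principal_axes:
  fixes M :: "real^'d::finite^'d" and F :: "real \<Rightarrow> real \<Rightarrow> ennreal"
  assumes "lists_singular_values M s" and [measurable]: "case_prod F \<in> borel_measurable borel"
  shows "(\<integral>\<^sup>+x. F ((norm (M *v x))\<^sup>2) ((norm x)\<^sup>2) \<partial>lborel) =
         (\<integral>\<^sup>+z. F (\<Sum>j\<in>UNIV. (s j)\<^sup>2 * (z $ j)\<^sup>2) (\<Sum>j\<in>UNIV. (z $ j)\<^sup>2) \<partial>lborel)"
proof -
  obtain Q where Q: "orthogonal_transformation Q"
      "\<And>z. (norm (M *v Q z))\<^sup>2 = (\<Sum>j\<in>UNIV. (s j)\<^sup>2 * (z $ j)\<^sup>2)" "\<And>j. 0 \<le> s j"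
    using lists_singular_values_imp_principal_axes[OF assms(1)] by blast
  have [measurable]: "(\<lambda>x. M *v x) \<in> borel_measurable borel"
    by (intro borel_measurable_continuous_onI linear_continuous_on) simp
  have "(\<lambda>x. case_prod F ((norm (M *v x))\<^sup>2, (norm x)\<^sup>2)) \<in> borel_measurable borel"
    by (rule measurable_compose[OF _ assms(2)]) (simp add: borel_prod[symmetric])
  then have "(\<integral>\<^sup>+x. F ((norm (M *v x))\<^sup>2) ((norm x)\<^sup>2) \<partial>lborel) =
      (\<integral>\<^sup>+z. F ((norm (M *v Q z))\<^sup>2) ((norm (Q z))\<^sup>2) \<partial>lborel)"
    by (intro nn_integral_lborel_orthogonal_transformation[OF Q(1), symmetric]) simp
  also have "(\<lambda>z. (norm (Q z))\<^sup>2) = (\<lambda>z. \<Sum>j\<in>UNIV. (z $ j)\<^sup>2)"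
    using orthogonal_transformation_norm[OF Q(1)]
    by (simp add: norm_vec_def L2_set_def sum_nonneg fun_eq_iff)
  finally show ?thesis
    by (simp add: Q(2))
qed

section \<open>One-dimensional estimates\<close>

lemma nn_integral_inverse_one_plus_square_le_pi:
  "(\<integral>\<^sup>+t. ennreal (inverse (1 + t\<^sup>2)) \<partial>lborel) \<le> ennreal pi"
proof -
  let ?h = "\<lambda>t::real. ennreal (inverse (1 + t\<^sup>2)) * indicator {0..} t"
  have half: "(\<integral>\<^sup>+t. ?h t \<partial>lborel) = ennreal (pi / 2 - arctan 0)"
    by (rule nn_integral_FTC_atLeast)
      (auto intro!: DERIV_arctan tendsto_arctan_at_top add_nonneg_nonneg)
  \<comment> \<open>The line is covered by the half line and its reflection, which overlap only at 0.\<close>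
  have "(\<integral>\<^sup>+t. ennreal (inverse (1 + t\<^sup>2)) \<partial>lborel) \<le> (\<integral>\<^sup>+t. ?h t + ?h (0 + (- 1) * t) \<partial>lborel)"
    by (intro nn_integral_mono) (auto simp: indicator_def)
  also have "\<dots> = (\<integral>\<^sup>+t. ?h t \<partial>lborel) + (\<integral>\<^sup>+t. ?h (0 + (- 1) * t) \<partial>lborel)"
    by (intro nn_integral_add) measurable
  also have "(\<integral>\<^sup>+t. ?h (0 + (- 1) * t) \<partial>lborel) = (\<integral>\<^sup>+t. ?h t \<partial>lborel)"
    by (subst (2) nn_integral_real_affine[of _ "- 1" 0]) auto
  also have "(\<integral>\<^sup>+t. ?h t \<partial>lborel) + (\<integral>\<^sup>+t. ?h t \<partial>lborel) = ennreal pi"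
    unfolding half by (simp flip: ennreal_plus)
  finally show ?thesis .
qed

text \<open>Dropping the first factor bounds the integral by \<open>\<pi>\<close>; dropping the second and rescaling bounds
  it by \<open>\<pi> / s\<close>.\<close>

lemma nn_integral_decay_product_le:
  fixes s :: real
  assumes "0 < s"
  shows "(\<integral>\<^sup>+t. ennreal (inverse (1 + s\<^sup>2 * t\<^sup>2) * inverse (1 + t\<^sup>2)) \<partial>lborel)
    \<le> ennreal (pi * min 1 (inverse s))"
proof -
  let ?I = "\<integral>\<^sup>+t. ennreal (inverse (1 + s\<^sup>2 * t\<^sup>2) * inverse (1 + t\<^sup>2)) \<partial>lborel"
  have le1: "inverse (1 + r * t\<^sup>2) \<le> 1" if "0 \<le> r" for r t :: real
    using that by (simp add: inverse_le_1_iff)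
  have "?I \<le> (\<integral>\<^sup>+t. ennreal (inverse (1 + t\<^sup>2)) \<partial>lborel)"
    using le1[of "s\<^sup>2"] by (intro nn_integral_mono ennreal_leI mult_left_le_one_le) auto
  then have "?I \<le> ennreal pi"
    using nn_integral_inverse_one_plus_square_le_pi by (rule order_trans)
  moreover have "?I \<le> ennreal (pi * inverse s)"
  proof -
    have "?I \<le> (\<integral>\<^sup>+t. ennreal (inverse (1 + s\<^sup>2 * t\<^sup>2)) \<partial>lborel)"
      using le1[of 1] by (intro nn_integral_mono ennreal_leI mult_right_le_one_le) auto
    also have "\<dots> = ennreal (inverse s) * (\<integral>\<^sup>+t. ennreal (inverse (1 + t\<^sup>2)) \<partial>lborel)"
      using assms by (subst nn_integral_real_affine[of _ "inverse s" 0])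
        (auto simp: power_mult_distrib power_inverse mult.assoc[symmetric])
    also have "\<dots> \<le> ennreal (inverse s) * ennreal pi"
      by (intro mult_left_mono nn_integral_inverse_one_plus_square_le_pi) simp
    finally show ?thesis
      using assms by (simp add: mult.commute flip: ennreal_mult)
  qed
  ultimately show ?thesis
    by (auto simp: min_def)
qed

lemma nn_integral_gaussian_product_ge:
  fixes s :: real
  assumes "0 < s"
  shows "ennreal (exp (- 2) * min 1 (inverse s))
    \<le> (\<integral>\<^sup>+t. ennreal (exp (- (s\<^sup>2 * t\<^sup>2)) * exp (- (t\<^sup>2))) \<partial>lborel)"
proof -
  let ?m = "min 1 (inverse s)"
  \<comment> \<open>On \<open>[0, min 1 (1/s)]\<close> both exponents are at least \<open>-1\<close>.\<close>
  have "exp (- 2) \<le> exp (- (s\<^sup>2 * t\<^sup>2)) * exp (- (t\<^sup>2))" if "t \<in> {0..?m}" for t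
  proof -
    have "0 \<le> t" "t \<le> 1" "s * t \<le> 1"
      using that assms by (auto simp: field_simps)
    then have "t\<^sup>2 \<le> 1" "(s * t)\<^sup>2 \<le> 1"
      using assms by (auto intro: power_le_one)
    then show ?thesis
      by (simp add: power_mult_distrib flip: exp_add)
  qed
  then have "(\<integral>\<^sup>+t. ennreal (exp (- 2)) * indicator {0..?m} t \<partial>lborel)
      \<le> (\<integral>\<^sup>+t. ennreal (exp (- (s\<^sup>2 * t\<^sup>2)) * exp (- (t\<^sup>2))) \<partial>lborel)"
    by (intro nn_integral_mono) (auto simp: indicator_def intro!: ennreal_leI)
  then show ?thesis
    using assms by (simp add: nn_integral_cmult ennreal_mult)
qed

section \<open>Kernel bounds in terms of singular values\<close>

text \<open>The exponent is the dimension, so that one factor \<open>1 + (norm x)\<^sup>2\<close> is available for each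
  coordinate; the weight is kept a function of the norm so that it is invariant under rotations.\<close>

definition decay :: "real^'d::finite \<Rightarrow> real" where
  "decay x = inverse ((1 + (norm x)\<^sup>2) ^ CARD('d))"

lemma decay_pos: "0 < decay x"
  by (simp add: decay_def add_pos_nonneg)

lemma borel_measurable_decay [measurable]: "decay \<in> borel_measurable borel"
  unfolding decay_def by measurable

definition gaussian :: "real^'d::finite \<Rightarrow> real" where
  "gaussian x = exp (- (norm x)\<^sup>2)"

lemma one_plus_sum_power_ge_prod:
  fixes a :: "'d::finite \<Rightarrow> real"
  assumes "\<And>j. 0 \<le> a j"
  shows "(\<Prod>j\<in>UNIV. 1 + a j) \<le> (1 + (\<Sum>j\<in>UNIV. a j)) ^ CARD('d)"
proof -
  have "(\<Prod>j\<in>UNIV. 1 + a j) \<le> (\<Prod>j\<in>(UNIV :: 'd set). 1 + (\<Sum>j\<in>UNIV. a j))"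
  proof (rule prod_mono)
    fix i
    have "a i \<le> (\<Sum>j\<in>UNIV. a j)"
      using assms by (intro member_le_sum) auto
    then show "0 \<le> 1 + a i \<and> 1 + a i \<le> 1 + (\<Sum>j\<in>UNIV. a j)"
      using assms[of i] by simp
  qed
  then show ?thesis
    by simp
qed

lemma prod_mono_ennreal:
  fixes f g :: "'i \<Rightarrow> ennreal"
  assumes "\<And>i. i \<in> I \<Longrightarrow> f i \<le> g i"
  shows "(\<Prod>i\<in>I. f i) \<le> (\<Prod>i\<in>I. g i)"
  using assms by (induction I rule: infinite_finite_induct) (auto intro: mult_mono)

text \<open>In principal axes \<open>decay (M x) * decay x\<close> is at most the product over \<open>j\<close> of the
  one-dimensional integrands of \<open>nn_integral_decay_product_le\<close>.\<close>

lemma decay_kernel_le: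
  fixes M :: "real^'d::finite^'d"
  assumes "lists_singular_values M s" "\<And>j. 0 < s j"
  shows "(\<integral>\<^sup>+x. ennreal (decay (M *v x) * decay x) \<partial>lborel)
    \<le> ennreal (pi ^ CARD('d) * (\<Prod>j\<in>UNIV. min 1 (inverse (s j))))"
proof -
  let ?d = "CARD('d)"
  define F where "F a b = ennreal (inverse ((1 + a) ^ ?d) * inverse ((1 + b) ^ ?d))" for a b :: real
  define h where "h j t = ennreal (inverse (1 + (s j)\<^sup>2 * t\<^sup>2) * inverse (1 + t\<^sup>2))" for j t
  have [measurable]: "case_prod F \<in> borel_measurable borel"
    unfolding F_def case_prod_beta borel_prod[symmetric] by measurable
  have "(\<integral>\<^sup>+x. ennreal (decay (M *v x) * decay x) \<partial>lborel)
      = (\<integral>\<^sup>+x. F ((norm (M *v x))\<^sup>2) ((norm x)\<^sup>2) \<partial>lborel)"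
    by (simp add: F_def decay_def)
  also have "\<dots> = (\<integral>\<^sup>+z. F (\<Sum>j\<in>UNIV. (s j)\<^sup>2 * (z $ j)\<^sup>2) (\<Sum>j\<in>UNIV. (z $ j)\<^sup>2) \<partial>lborel)"
    by (rule nn_integral_principal_axes[OF assms(1)]) simp
  also have "\<dots> \<le> (\<integral>\<^sup>+z. (\<Prod>j\<in>UNIV. h j ((z::real^'d) $ j)) \<partial>lborel)"
  proof (rule nn_integral_mono)
    fix z :: "real^'d"
    have le: "inverse ((1 + (\<Sum>j\<in>UNIV. a j)) ^ ?d) \<le> (\<Prod>j\<in>UNIV. inverse (1 + a j))"
      if "\<And>j. 0 \<le> a j" for a :: "'d \<Rightarrow> real"
    proof -
      have "inverse ((1 + (\<Sum>j\<in>UNIV. a j)) ^ ?d) \<le> inverse (\<Prod>j\<in>UNIV. 1 + a j)"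
        using one_plus_sum_power_ge_prod[of a] that
        by (intro le_imp_inverse_le prod_pos) (auto intro: add_pos_nonneg)
      then show ?thesis
        by (simp add: prod_inversef[unfolded comp_def])
    qed
    have "F (\<Sum>j\<in>UNIV. (s j)\<^sup>2 * (z $ j)\<^sup>2) (\<Sum>j\<in>UNIV. (z $ j)\<^sup>2) \<le>
        ennreal ((\<Prod>j\<in>UNIV. inverse (1 + (s j)\<^sup>2 * (z $ j)\<^sup>2)) * (\<Prod>j\<in>UNIV. inverse (1 + (z $ j)\<^sup>2)))"
      unfolding F_def
      by (intro ennreal_leI mult_mono le) (auto intro!: prod_nonneg simp: sum_nonneg add_nonneg_nonneg)
    then show "F (\<Sum>j\<in>UNIV. (s j)\<^sup>2 * (z $ j)\<^sup>2) (\<Sum>j\<in>UNIV. (z $ j)\<^sup>2) \<le> (\<Prod>j\<in>UNIV. h j (z $ j))"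
      by (simp add: h_def prod_ennreal prod.distrib)
  qed
  also have "\<dots> = (\<Prod>j\<in>UNIV. \<integral>\<^sup>+t. h j t \<partial>lborel)"
    by (rule nn_integral_lborel_vec_prod) (unfold h_def, measurable)
  also have "\<dots> \<le> (\<Prod>j\<in>UNIV. ennreal (pi * min 1 (inverse (s j))))"
    unfolding h_def using assms(2) by (intro prod_mono_ennreal nn_integral_decay_product_le) auto
  also have "\<dots> = ennreal (pi ^ ?d * (\<Prod>j\<in>UNIV. min 1 (inverse (s j))))"
    using assms(2) by (subst prod_ennreal) (auto simp: prod.distrib less_imp_le)
  finally show ?thesis .
qed

text \<open>The Gaussian turns the sums of squares in principal axes into an exact product, so that no
  inequality is lost before the one-dimensional estimate.\<close>

lemma gaussian_kernel_ge:
  fixes M :: "real^'d::finite^'d"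
  assumes "lists_singular_values M s" "\<And>j. 0 < s j"
  shows "ennreal (exp (- 2) ^ CARD('d) * (\<Prod>j\<in>UNIV. min 1 (inverse (s j))))
    \<le> (\<integral>\<^sup>+x. ennreal (gaussian (M *v x) * gaussian x) \<partial>lborel)"
proof -
  define F where "F a b = ennreal (exp (- a) * exp (- b))" for a b :: real
  define h where "h j t = ennreal (exp (- ((s j)\<^sup>2 * t\<^sup>2)) * exp (- (t\<^sup>2)))" for j t
  have [measurable]: "case_prod F \<in> borel_measurable borel"
    unfolding F_def case_prod_beta borel_prod[symmetric] by measurable
  have "ennreal (exp (- 2) ^ CARD('d) * (\<Prod>j\<in>UNIV. min 1 (inverse (s j))))
      = (\<Prod>j\<in>UNIV. ennreal (exp (- 2) * min 1 (inverse (s j))))"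
    using assms(2) by (subst prod_ennreal) (auto simp: prod.distrib less_imp_le)
  also have "\<dots> \<le> (\<Prod>j\<in>UNIV. \<integral>\<^sup>+t. h j t \<partial>lborel)"
    unfolding h_def using assms(2) by (intro prod_mono_ennreal nn_integral_gaussian_product_ge) auto
  also have "\<dots> = (\<integral>\<^sup>+z. (\<Prod>j\<in>UNIV. h j ((z::real^'d) $ j)) \<partial>lborel)"
    by (rule nn_integral_lborel_vec_prod[symmetric]) (unfold h_def, measurable)
  also have "\<dots> = (\<integral>\<^sup>+z. F (\<Sum>j\<in>UNIV. (s j)\<^sup>2 * (z $ j)\<^sup>2) (\<Sum>j\<in>UNIV. (z $ j)\<^sup>2) \<partial>lborel)"
    by (simp add: h_def F_def prod_ennreal prod.distrib exp_sum flip: sum_negf)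
  also have "\<dots> = (\<integral>\<^sup>+x. F ((norm (M *v x))\<^sup>2) ((norm x)\<^sup>2) \<partial>lborel)"
    by (rule nn_integral_principal_axes[OF assms(1), symmetric]) simp
  finally show ?thesis
    by (simp add: F_def gaussian_def)
qed

section \<open>Schwartz functions and their topology\<close>

lemma schwartz_bounded: "f \<in> schwartz \<Longrightarrow> bounded (range (weighted_deriv \<alpha> is f))"
  by (simp add: schwartz_def)

lemma schwartz_measurable:
  assumes "f \<in> schwartz"
  shows "f \<in> borel_measurable borel"
proof -
  have "partial_derivs [] f differentiable at x" for x
    using assms unfolding schwartz_def smooth_def by blast
  then have "continuous_on UNIV f"
    by (simp add: partial_derivs_def continuous_at_imp_continuous_on differentiable_imp_continuous_within)
  then show ?thesis
    by (rule borel_measurable_continuous_onI)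
qed

lemma schwartz_seminorm_zero: "schwartz_seminorm \<alpha> is (\<lambda>x. 0) = 0"
proof -
  have "partial_derivs is (\<lambda>x. 0) = (\<lambda>x. 0 :: complex)"
    by (induction "is") (simp_all add: partial_derivs_def partial_deriv_def[abs_def])
  then show ?thesis
    by (simp add: schwartz_seminorm_def weighted_deriv_def)
qed

text \<open>The multi-indices \<open>0\<close> (at \<open>None\<close>) and \<open>2d\<close> times a unit vector (at \<open>Some i\<close>): these
  monomials alone control the \<open>d\<close>-th power of \<open>1 + (norm x)\<^sup>2\<close>.\<close>

definition decay_index :: "'d option \<Rightarrow> 'd::finite \<Rightarrow> nat" where
  "decay_index k j = (if k = Some j then 2 * CARD('d) else 0)"

definition decay_seminorm :: "(real^'d::finite \<Rightarrow> complex) \<Rightarrow> real" where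
  "decay_seminorm f =
     (2 * real CARD('d)) ^ CARD('d) * (\<Sum>k\<in>UNIV. schwartz_seminorm (decay_index k) [] f)"

lemma inverse_decay_le_sum_monomials:
  fixes x :: "real^'d::finite"
  shows "inverse (decay x) \<le>
    (2 * real CARD('d)) ^ CARD('d) * (\<Sum>k\<in>UNIV. \<Prod>i\<in>UNIV. (x $ i) ^ decay_index k i)"
proof -
  let ?d = "CARD('d)"
  \<comment> \<open>Comparing with the largest square of a coordinate avoids mixed monomials.\<close>
  define m where "m = Max (range (\<lambda>i. (x $ i)\<^sup>2))"
  have m: "(x $ i)\<^sup>2 \<le> m" for i
    by (simp add: m_def)
  obtain k where k: "m = (x $ k)\<^sup>2"
    using Max_in[of "range (\<lambda>i. (x $ i)\<^sup>2)"] unfolding m_def by (simp add: image_iff) blast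
  have d: "1 \<le> real ?d"
    by (simp add: Suc_le_eq)
  have m0: "0 \<le> m"
    by (simp add: k)
  have "(norm x)\<^sup>2 = (\<Sum>i\<in>UNIV. (x $ i)\<^sup>2)"
    by (simp add: norm_vec_def L2_set_def sum_nonneg)
  also have "\<dots> \<le> real ?d * m"
    using sum_bounded_above[of UNIV "\<lambda>i. (x $ i)\<^sup>2" m] m by simp
  finally have "1 + (norm x)\<^sup>2 \<le> real ?d * 1 + real ?d * m"
    using d by linarith
  also have "\<dots> \<le> real ?d * max 1 m + real ?d * max 1 m"
    by (intro add_mono mult_left_mono) auto
  finally have "(1 + (norm x)\<^sup>2) ^ ?d \<le> (2 * real ?d * max 1 m) ^ ?d"
    by (intro power_mono) auto
  also have "\<dots> = (2 * real ?d) ^ ?d * (max 1 m) ^ ?d"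
    by (simp add: power_mult_distrib)
  also have "(max 1 m) ^ ?d \<le> 1 + m ^ ?d"
    using m0 by (simp add: max_def)
  also have "m ^ ?d = (x $ k) ^ (2 * ?d)"
    by (simp add: k power_mult)
  also have "\<dots> \<le> (\<Sum>i\<in>UNIV. (x $ i) ^ (2 * ?d))"
    by (rule member_le_sum) auto
  also have "1 + \<dots> = (\<Sum>k\<in>UNIV. \<Prod>i\<in>UNIV. (x $ i) ^ decay_index k i)"
    by (simp add: UNIV_option_conv sum.reindex decay_index_def if_distrib[of "(^) _"] cong: if_cong)
  finally show ?thesis
    by (simp add: decay_def)
qed

text \<open>The hypothesis concerns only the values of \<open>f\<close>. For a difference of Schwartz functions it follows
  by linearity, whereas the derivatives of a difference would need an induction.\<close>

lemma norm_le_decay_seminorm: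
  fixes f :: "real^'d::finite \<Rightarrow> complex"
  assumes "\<And>\<alpha>. bounded (range (weighted_deriv \<alpha> [] f))"
  shows "norm (f x) \<le> decay_seminorm f * decay x"
proof -
  let ?C = "(2 * real CARD('d)) ^ CARD('d)"
  let ?m = "\<lambda>k. \<Prod>i\<in>UNIV. (x $ i) ^ decay_index k i"
  have sup: "norm (weighted_deriv \<alpha> [] f x) \<le> schwartz_seminorm \<alpha> [] f" for \<alpha>
    unfolding schwartz_seminorm_def
    using assms[of \<alpha>] by (intro cSUP_upper) (auto simp: bounded_iff bdd_above_def)
  have "inverse (decay x) * norm (f x) \<le> ?C * (\<Sum>k\<in>UNIV. ?m k) * norm (f x)"
    by (intro mult_right_mono inverse_decay_le_sum_monomials) simp
  also have "\<dots> = ?C * (\<Sum>k\<in>UNIV. ?m k * norm (f x))"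
    by (simp add: sum_distrib_right)
  also have "\<dots> \<le> decay_seminorm f"
    unfolding decay_seminorm_def
  proof (intro mult_left_mono sum_mono)
    fix k :: "'d option"
    have "?m k * norm (f x) \<le> norm (weighted_deriv (decay_index k) [] f x)"
      by (simp add: weighted_deriv_def partial_derivs_def mult_right_mono)
    then show "?m k * norm (f x) \<le> schwartz_seminorm (decay_index k) [] f"
      using sup order_trans by blast
  qed simp
  finally show ?thesis
    using decay_pos[of x] by (simp add: field_simps)
qed

lemma bounded_weighted_diff:
  assumes "f \<in> schwartz" "g \<in> schwartz"
  shows "bounded (range (weighted_deriv \<alpha> [] (\<lambda>x. f x - g x)))"
proof -
  have "weighted_deriv \<alpha> [] (\<lambda>x. f x - g x) x = weighted_deriv \<alpha> [] f x - weighted_deriv \<alpha> [] g x" for x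
    by (simp add: weighted_deriv_def partial_derivs_def algebra_simps)
  then show ?thesis
    using bounded_minus_comp[OF schwartz_bounded[OF assms(1)] schwartz_bounded[OF assms(2)], of \<alpha> "[]" \<alpha> "[]"]
    by simp
qed

lemma openin_schwartz_seminorm_ball:
  assumes "h \<in> schwartz" "0 < e"
  shows "openin schwartz_topology {g \<in> schwartz. schwartz_seminorm \<alpha> is (\<lambda>x. g x - h x) < e}"
  unfolding schwartz_topology_def using assms by (intro topology_generated_by_Basis) blast

lemma topspace_schwartz_topology:
  "topspace schwartz_topology = (schwartz :: (real^'d::finite \<Rightarrow> complex) set)"
proof
  show "topspace schwartz_topology \<subseteq> (schwartz :: (real^'d \<Rightarrow> complex) set)"
    by (auto simp: schwartz_topology_def)
  show "(schwartz :: (real^'d \<Rightarrow> complex) set) \<subseteq> topspace schwartz_topology"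
  proof
    fix h :: "real^'d \<Rightarrow> complex" assume h: "h \<in> schwartz"
    then have "h \<in> {g \<in> schwartz. schwartz_seminorm (\<lambda>_. 0) [] (\<lambda>x. g x - h x) < 1}"
      by (simp add: schwartz_seminorm_zero)
    then show "h \<in> topspace schwartz_topology"
      using openin_subset[OF openin_schwartz_seminorm_ball[OF h, of 1 "\<lambda>_. 0" "[]"]] by auto
  qed
qed

text \<open>The finitely many seminorm balls around \<open>h\<close> of a small common radius intersect in an open
  neighbourhood on which \<open>u\<close> stays close to \<open>u h\<close>.\<close>

lemma continuous_map_schwartz_topology:
  fixes u :: "(real^'d::finite \<Rightarrow> complex) \<Rightarrow> complex"
  assumes "finite K" and "0 \<le> C"
    and bound: "\<And>g h. g \<in> schwartz \<Longrightarrow> h \<in> schwartz \<Longrightarrow>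
      norm (u g - u h) \<le> C * (\<Sum>k\<in>K. schwartz_seminorm (\<alpha> k) (\<beta> k) (\<lambda>x. g x - h x))"
  shows "continuous_map schwartz_topology euclidean u"
proof (clarsimp simp: continuous_map_def)
  fix U :: "complex set" assume "open U"
  let ?p = "\<lambda>k. schwartz_seminorm (\<alpha> k) (\<beta> k)"
  show "openin schwartz_topology {g \<in> topspace schwartz_topology. u g \<in> U}"
  proof (subst openin_subopen, safe)
    fix h assume "h \<in> topspace schwartz_topology" "u h \<in> U"
    then have h: "h \<in> schwartz"
      by (simp add: topspace_schwartz_topology)
    obtain e where e: "0 < e" "\<And>w. dist w (u h) < e \<Longrightarrow> w \<in> U"
      using \<open>open U\<close> \<open>u h \<in> U\<close> by (auto simp: open_dist)
    \<comment> \<open>The constants are enlarged by 1 so that \<open>C = 0\<close> and \<open>K = {}\<close> need no separate treatment.\<close>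
    define r where "r = e / (2 * ((C + 1) * (real (card K) + 1)))"
    have r: "0 < r"
      using e \<open>0 \<le> C\<close> by (simp add: r_def add_pos_nonneg)
    define N where "N = topspace schwartz_topology \<inter>
      \<Inter> ((\<lambda>k. {g \<in> schwartz. ?p k (\<lambda>x. g x - h x) < r}) ` K)"
    have "openin schwartz_topology N"
      unfolding N_def using \<open>finite K\<close> h r
      by (intro openin_Int_Inter) (auto intro: openin_schwartz_seminorm_ball)
    moreover have "h \<in> N"
      using h r by (auto simp: N_def topspace_schwartz_topology schwartz_seminorm_zero)
    moreover have "u g \<in> U" if "g \<in> N" for g
    proof -
      have g: "g \<in> schwartz" "\<And>k. k \<in> K \<Longrightarrow> ?p k (\<lambda>x. g x - h x) < r"
        using that by (auto simp: N_def topspace_schwartz_topology)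
      have "norm (u g - u h) \<le> C * (\<Sum>k\<in>K. ?p k (\<lambda>x. g x - h x))"
        using g h by (intro bound)
      also have "\<dots> \<le> C * (\<Sum>k\<in>K. r)"
        using g(2) \<open>0 \<le> C\<close> by (intro mult_left_mono sum_mono) (auto intro: less_imp_le)
      also have "\<dots> \<le> (C + 1) * ((real (card K) + 1) * r)"
        using r \<open>0 \<le> C\<close> by (simp add: mult_mono)
      also have "\<dots> < e"
        using e \<open>0 \<le> C\<close> by (simp add: r_def field_simps add_pos_nonneg)
      finally show ?thesis
        by (intro e(2)) (simp add: dist_norm)
    qed
    ultimately show "\<exists>T. openin schwartz_topology T \<and> h \<in> T \<and>
        T \<subseteq> {g \<in> topspace schwartz_topology. u g \<in> U}"
      using openin_subset by blast
  qed
qed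

section \<open>The Gaussian is a Schwartz function\<close>

lemma real_polynomial_function_directional_derivative:
  assumes "real_polynomial_function p"
  shows "real_polynomial_function (\<lambda>x. frechet_derivative p (at x) v)"
  using assms
proof (induction p rule: real_polynomial_function.induct)
  case (linear f)
  then have "frechet_derivative f (at x) = f" for x
    by (metis bounded_linear_imp_has_derivative frechet_derivative_at)
  then show ?case
    by (simp add: real_polynomial_function.intros(2))
next
  case (const c)
  then show ?case
    by (simp add: real_polynomial_function.intros(2))
next
  case (add f g)
  have "frechet_derivative (\<lambda>x. f x + g x) (at x) =
      (\<lambda>h. frechet_derivative f (at x) h + frechet_derivative g (at x) h)" for x
    using add.hyps
    by (intro frechet_derivative_at[symmetric] has_derivative_add)
      (simp_all add: differentiable_at_real_polynomial_function flip: frechet_derivative_works)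
  then show ?case
    using add by (simp add: real_polynomial_function.intros(3))
next
  case (mult f g)
  have "frechet_derivative (\<lambda>x. f x * g x) (at x) =
      (\<lambda>h. f x * frechet_derivative g (at x) h + frechet_derivative f (at x) h * g x)" for x
    using mult.hyps
    by (intro frechet_derivative_at[symmetric] has_derivative_mult)
      (simp_all add: differentiable_at_real_polynomial_function flip: frechet_derivative_works)
  then show ?case
    using mult by (simp add: real_polynomial_function.intros(3) real_polynomial_function.intros(4))
qed

text \<open>Products of a polynomial with the Gaussian are closed under differentiation. This makes it possible
  to handle all iterated derivatives without computing them.\<close>

lemma polynomial_gaussian_partial_deriv:
  fixes p :: "real^'d::finite \<Rightarrow> real"
  assumes p: "real_polynomial_function p"
  shows "(\<lambda>x. complex_of_real (p x * gaussian x)) differentiable at x"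
    and "\<exists>q. real_polynomial_function q \<and>
      partial_deriv i (\<lambda>x. complex_of_real (p x * gaussian x)) = (\<lambda>x. complex_of_real (q x * gaussian x))"
proof -
  let ?p' = "\<lambda>x. frechet_derivative p (at x)"
  have D: "((\<lambda>x. complex_of_real (p x * gaussian x)) has_derivative
      (\<lambda>h. complex_of_real (p x * (gaussian x * - (2 * (x \<bullet> h))) + ?p' x h * gaussian x))) (at x)" for x
  proof -
    have "(gaussian has_derivative (\<lambda>h. gaussian x * - (2 * (x \<bullet> h)))) (at x)"
      unfolding gaussian_def[abs_def] power2_norm_eq_inner
      by (auto intro!: derivative_eq_intros simp: inner_commute algebra_simps)
    moreover have "(p has_derivative ?p' x) (at x)"
      using p by (simp add: differentiable_at_real_polynomial_function flip: frechet_derivative_works)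
    ultimately show ?thesis
      by (intro has_derivative_of_real has_derivative_mult)
  qed
  show "(\<lambda>x. complex_of_real (p x * gaussian x)) differentiable at x"
    using D by (auto simp: differentiable_def)
  \<comment> \<open>The directional derivative of \<open>gaussian\<close> along axis \<open>i\<close> is \<open>- 2 * (x $ i) * gaussian x\<close>.\<close>
  define q where "q x = ?p' x (axis i 1) - 2 * (p x * (x $ i))" for x
  have "real_polynomial_function (\<lambda>x::real^'d. x $ i)"
    by (intro real_polynomial_function.intros(1) bounded_linear_vec_nth)
  then have "real_polynomial_function q"
    unfolding q_def[abs_def] using p
    by (intro real_polynomial_function_diff real_polynomial_function_directional_derivative
        real_polynomial_function.intros(4) real_polynomial_function.intros(2))
  moreover have "partial_deriv i (\<lambda>x. complex_of_real (p x * gaussian x)) x = complex_of_real (q x * gaussian x)" for x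
    unfolding partial_deriv_def frechet_derivative_at[OF D, symmetric] q_def
    by (simp add: inner_axis algebra_simps)
  ultimately show "\<exists>q. real_polynomial_function q \<and>
      partial_deriv i (\<lambda>x. complex_of_real (p x * gaussian x)) = (\<lambda>x. complex_of_real (q x * gaussian x))"
    by blast
qed

lemma polynomial_gaussian_partial_derivs:
  fixes p :: "real^'d::finite \<Rightarrow> real"
  assumes "real_polynomial_function p"
  shows "\<exists>q. real_polynomial_function q \<and>
    partial_derivs is (\<lambda>x. complex_of_real (p x * gaussian x)) = (\<lambda>x. complex_of_real (q x * gaussian x))"
proof (induction "is")
  case Nil
  then show ?case
    using assms by (auto simp: partial_derivs_def)
next
  case (Cons i "is")
  then obtain q where q: "real_polynomial_function q"
      "partial_derivs is (\<lambda>x. complex_of_real (p x * gaussian x)) = (\<lambda>x. complex_of_real (q x * gaussian x))"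
    by blast
  then show ?case
    using polynomial_gaussian_partial_deriv(2)[OF q(1), of i] by (simp add: partial_derivs_def)
qed

lemma real_polynomial_function_growth:
  fixes p :: "'a::real_normed_vector \<Rightarrow> real"
  assumes "real_polynomial_function p"
  shows "\<exists>C k. 0 \<le> C \<and> (\<forall>x. \<bar>p x\<bar> \<le> C * (1 + norm x) ^ k)"
  using assms
proof (induction p rule: real_polynomial_function.induct)
  case (linear f)
  then obtain K where K: "0 < K" "\<And>x. norm (f x) \<le> norm x * K"
    using bounded_linear.pos_bounded by blast
  have "\<bar>f x\<bar> \<le> K * (1 + norm x) ^ 1" for x
    using K(2)[of x] K(1) by (simp add: algebra_simps)
  then show ?case
    using K(1) less_imp_le by blast
next
  case (const c)
  have "\<bar>c\<bar> \<le> \<bar>c\<bar> * (1 + norm x) ^ 0" for x :: 'a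
    by simp
  then show ?case
    using abs_ge_zero by blast
next
  case (add f g)
  then obtain C k D l where *: "0 \<le> C" "\<And>x. \<bar>f x\<bar> \<le> C * (1 + norm x) ^ k"
      "0 \<le> D" "\<And>x. \<bar>g x\<bar> \<le> D * (1 + norm x) ^ l"
    by blast
  have "\<bar>f x + g x\<bar> \<le> (C + D) * (1 + norm x) ^ (k + l)" for x
  proof -
    have "\<bar>f x\<bar> \<le> C * (1 + norm x) ^ (k + l)"
      using *(1) by (intro order_trans[OF *(2)] mult_left_mono power_increasing) auto
    moreover have "\<bar>g x\<bar> \<le> D * (1 + norm x) ^ (k + l)"
      using *(3) by (intro order_trans[OF *(4)] mult_left_mono power_increasing) auto
    ultimately show ?thesis
      using abs_triangle_ineq[of "f x" "g x"] by (simp add: distrib_right)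
  qed
  then show ?case
    using *(1,3) add_nonneg_nonneg by blast
next
  case (mult f g)
  then obtain C k D l where *: "0 \<le> C" "\<And>x. \<bar>f x\<bar> \<le> C * (1 + norm x) ^ k"
      "0 \<le> D" "\<And>x. \<bar>g x\<bar> \<le> D * (1 + norm x) ^ l"
    by blast
  have "\<bar>f x * g x\<bar> \<le> (C * D) * (1 + norm x) ^ (k + l)" for x
  proof -
    have "\<bar>f x * g x\<bar> \<le> (C * (1 + norm x) ^ k) * (D * (1 + norm x) ^ l)"
      unfolding abs_mult using * by (intro mult_mono) auto
    then show ?thesis
      by (simp add: power_add algebra_simps)
  qed
  then show ?case
    using *(1,3) mult_nonneg_nonneg by blast
qed

text \<open>By \<open>1 + r \<le> e\<^sup>r\<close>, a polynomial of degree \<open>k\<close> times the Gaussian is at most a constant times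
  \<open>exp (k r - r\<^sup>2)\<close> with \<open>r = norm x\<close>, and this exponent is bounded above.\<close>

lemma bounded_polynomial_gaussian:
  fixes p :: "real^'d::finite \<Rightarrow> real"
  assumes "real_polynomial_function p"
  shows "bounded (range (\<lambda>x. p x * gaussian x))"
proof -
  obtain C k where C: "0 \<le> C" "\<And>x. \<bar>p x\<bar> \<le> C * (1 + norm x) ^ k"
    using real_polynomial_function_growth[OF assms] by blast
  have "\<bar>p x * gaussian x\<bar> \<le> C * exp ((real k)\<^sup>2)" for x
  proof -
    have "(1 + norm x) ^ k \<le> exp (norm x) ^ k"
      by (intro power_mono exp_ge_add_one_self) simp
    then have "(1 + norm x) ^ k * gaussian x \<le> exp (real k * norm x) * exp (- (norm x)\<^sup>2)"
      by (simp add: gaussian_def exp_of_nat_mult)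
    also have "\<dots> = exp (real k * norm x - (norm x)\<^sup>2)"
      by (simp add: exp_diff exp_minus divide_inverse)
    also have "\<dots> \<le> exp ((real k)\<^sup>2)"
    proof -
      \<comment> \<open>This sum of squares is twice \<open>k\<^sup>2 - k * norm x + (norm x)\<^sup>2\<close>.\<close>
      have "0 \<le> (real k - norm x)\<^sup>2 + (norm x)\<^sup>2 + (real k)\<^sup>2"
        by simp
      then show ?thesis
        by (simp add: power2_diff)
    qed
    finally have "C * ((1 + norm x) ^ k * gaussian x) \<le> C * exp ((real k)\<^sup>2)"
      using C(1) by (rule mult_left_mono)
    moreover have "\<bar>p x * gaussian x\<bar> \<le> C * (1 + norm x) ^ k * gaussian x"
      using C(2)[of x] by (simp add: abs_mult gaussian_def)
    ultimately show ?thesis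
      by simp
  qed
  then show ?thesis
    by (auto simp: bounded_iff)
qed

lemma gaussian_in_schwartz:
  "(\<lambda>x::real^'d::finite. complex_of_real (gaussian x)) \<in> schwartz"
proof -
  have one: "real_polynomial_function (\<lambda>x::real^'d. 1)"
    by (rule real_polynomial_function.intros(2))
  have "partial_derivs is (\<lambda>x. complex_of_real (gaussian x)) differentiable at x"
    and "bounded (range (weighted_deriv \<alpha> is (\<lambda>x. complex_of_real (gaussian x))))"
    for \<alpha> "is" and x :: "real^'d"
  proof -
    obtain q where q: "real_polynomial_function q"
        "partial_derivs is (\<lambda>x::real^'d. complex_of_real (gaussian x)) = (\<lambda>x. complex_of_real (q x * gaussian x))"
      using polynomial_gaussian_partial_derivs[OF one, of "is"] by auto
    show "partial_derivs is (\<lambda>x. complex_of_real (gaussian x)) differentiable at x"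
      unfolding q(2) by (rule polynomial_gaussian_partial_deriv(1)[OF q(1)])
    have "real_polynomial_function (\<lambda>x::real^'d. \<Prod>i\<in>UNIV. (x $ i) ^ \<alpha> i)"
      by (intro real_polynomial_function_prod real_polynomial_function_power
          real_polynomial_function.intros(1) bounded_linear_vec_nth) simp
    then have "real_polynomial_function (\<lambda>x. (\<Prod>i\<in>UNIV. (x $ i) ^ \<alpha> i) * q x)"
      using q(1) by (rule real_polynomial_function.intros(4))
    from bounded_polynomial_gaussian[OF this]
    have "bounded (range (\<lambda>x. complex_of_real ((\<Prod>i\<in>UNIV. (x $ i) ^ \<alpha> i) * q x * gaussian x)))"
      by (simp add: bounded_iff del: of_real_mult of_real_prod of_real_power)
    then show "bounded (range (weighted_deriv \<alpha> is (\<lambda>x. complex_of_real (gaussian x))))"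
      unfolding weighted_deriv_def[abs_def] q(2) by (simp add: scaleR_conv_of_real mult.assoc)
  qed
  then show ?thesis
    by (auto simp: schwartz_def smooth_def)
qed

section \<open>The double integral\<close>

lemma sigma_finite_lebesgue: "sigma_finite_measure (lebesgue :: 'a::euclidean_space measure)"
proof
  obtain X :: "'a set set" where "countable X" "X \<subseteq> sets lborel" "\<Union> X = space lborel"
      "\<forall>a\<in>X. emeasure lborel a \<noteq> \<infinity>"
    using lborel.sigma_finite_countable by blast
  then show "\<exists>X::'a set set. countable X \<and> X \<subseteq> sets lebesgue \<and> \<Union> X = space lebesgue \<and>
      (\<forall>a\<in>X. emeasure lebesgue a \<noteq> \<infinity>)"
    by (intro exI[of _ X]) (auto simp: subset_iff)
qed

interpretation lebesgue_pair:
  pair_sigma_finite "lebesgue :: 'a::euclidean_space measure" "lebesgue :: 'b::euclidean_space measure"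
  by (intro pair_sigma_finite.intro sigma_finite_lebesgue)

lemma borel_measurable_matrix_vector_mult_family:
  fixes A :: "real^'n::finite \<Rightarrow> real^'d^'d::finite"
  assumes "A \<in> borel_measurable lebesgue"
  shows "(\<lambda>(x, y). A y *v x) \<in> borel_measurable (lebesgue \<Otimes>\<^sub>M lebesgue)"
proof -
  have id: "(\<lambda>x. x) \<in> borel_measurable (lebesgue :: (real^'d) measure)"
    by (rule measurable_completion) simp
  have "continuous_on UNIV (\<lambda>p :: (real^'d^'d) \<times> (real^'d). fst p *v snd p)"
    unfolding matrix_vector_mult_def by (intro continuous_intros)
  then have "(\<lambda>p. A (snd p) *v fst p) \<in> borel_measurable (lebesgue \<Otimes>\<^sub>M lebesgue)"
    by (rule borel_measurable_continuous_Pair[OF measurable_compose[OF measurable_snd assms]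
          measurable_compose[OF measurable_fst id]])
  then show ?thesis
    by (simp add: case_prod_beta)
qed

lemma hausdorff_integrand_measurable:
  fixes \<Phi> :: "real^'n::finite \<Rightarrow> 'c::{real_normed_algebra, second_countable_topology}"
    and A :: "real^'n \<Rightarrow> real^'d^'d::finite"
  assumes [measurable]: "\<Phi> \<in> borel_measurable lebesgue" "A \<in> borel_measurable lebesgue"
    and [measurable]: "f \<in> borel_measurable borel" "g \<in> borel_measurable borel"
  shows "(\<lambda>(x, y). \<Phi> y * f (A y *v x) * g x) \<in> borel_measurable (lebesgue \<Otimes>\<^sub>M lebesgue)"
proof -
  have [measurable]: "g \<in> borel_measurable lebesgue"
    using assms(4) by (simp add: measurable_completion)
  note borel_measurable_matrix_vector_mult_family[OF assms(2), measurable]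
  show ?thesis
    by measurable
qed

text \<open>Tonelli: the absolute double integral is the integral of \<open>\<bar>\<Phi>\<bar>\<close> against the kernel of the
  weight.\<close>

lemma nn_integral_hausdorff_kernel:
  fixes \<Phi> :: "real^'n::finite \<Rightarrow> complex" and A :: "real^'n \<Rightarrow> real^'d^'d::finite"
    and w :: "real^'d \<Rightarrow> real"
  assumes \<Phi>: "\<Phi> \<in> borel_measurable lebesgue" and A: "A \<in> borel_measurable lebesgue"
    and w: "w \<in> borel_measurable borel" "\<And>x. 0 \<le> w x"
  shows "(\<lambda>y. ennreal (norm (\<Phi> y)) * (\<integral>\<^sup>+x. ennreal (w (A y *v x) * w x) \<partial>lborel)) \<in> borel_measurable lebesgue"
    and "(\<integral>\<^sup>+(x, y). ennreal (norm (\<Phi> y) * w (A y *v x) * w x) \<partial>(lebesgue \<Otimes>\<^sub>M lebesgue)) =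
      (\<integral>\<^sup>+y. ennreal (norm (\<Phi> y)) * (\<integral>\<^sup>+x. ennreal (w (A y *v x) * w x) \<partial>lborel) \<partial>lebesgue)"
proof -
  let ?h = "\<lambda>(x, y). ennreal (norm (\<Phi> y) * w (A y *v x) * w x)"
  have "(\<lambda>(x, y). norm (\<Phi> y) * w (A y *v x) * w x) \<in> borel_measurable (lebesgue \<Otimes>\<^sub>M lebesgue)"
    using assms by (intro hausdorff_integrand_measurable) auto
  then have h: "?h \<in> borel_measurable (lebesgue \<Otimes>\<^sub>M lebesgue)"
    by (simp add: case_prod_beta)
  have inner: "(\<integral>\<^sup>+x. ?h (x, y) \<partial>lebesgue) =
      ennreal (norm (\<Phi> y)) * (\<integral>\<^sup>+x. ennreal (w (A y *v x) * w x) \<partial>lborel)" for y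
  proof -
    have "(\<lambda>x. A y *v x) \<in> borel_measurable borel"
      by (intro borel_measurable_continuous_onI linear_continuous_on) simp
    then have "(\<lambda>x. w (A y *v x)) \<in> borel_measurable borel"
      using w(1) by (rule measurable_compose)
    then have "(\<integral>\<^sup>+x. ennreal (norm (\<Phi> y)) * ennreal (w (A y *v x) * w x) \<partial>lborel) =
        ennreal (norm (\<Phi> y)) * (\<integral>\<^sup>+x. ennreal (w (A y *v x) * w x) \<partial>lborel)"
      using w(1) by (intro nn_integral_cmult) simp
    then show ?thesis
      using w(2) by (simp add: nn_integral_completion ennreal_mult mult.assoc)
  qed
  have "(\<lambda>y. \<integral>\<^sup>+x. ?h (x, y) \<partial>lebesgue) \<in> borel_measurable lebesgue"
    using sigma_finite_measure.borel_measurable_nn_integral_fst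
      [OF sigma_finite_lebesgue measurable_pair_swap[OF h]]
    by simp
  then show "(\<lambda>y. ennreal (norm (\<Phi> y)) * (\<integral>\<^sup>+x. ennreal (w (A y *v x) * w x) \<partial>lborel)) \<in> borel_measurable lebesgue"
    unfolding inner .
  show "(\<integral>\<^sup>+(x, y). ennreal (norm (\<Phi> y) * w (A y *v x) * w x) \<partial>(lebesgue \<Otimes>\<^sub>M lebesgue)) =
      (\<integral>\<^sup>+y. ennreal (norm (\<Phi> y)) * (\<integral>\<^sup>+x. ennreal (w (A y *v x) * w x) \<partial>lborel) \<partial>lebesgue)"
    using lebesgue_pair.nn_integral_snd[OF h] unfolding inner by simp
qed

text \<open>The constant is moved to the side of the measurable function \<open>w\<close> before it is taken out of the
  integral. This allows \<open>G\<close> to be the product formed from the singular values without a study of how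
  they vary with \<open>y\<close>.\<close>

lemma nn_integral_finite_dominated:
  assumes "w \<in> borel_measurable M" "0 \<le> c" "\<And>y. w y \<le> ennreal c * G y" "(\<integral>\<^sup>+y. G y \<partial>M) < \<infinity>"
  shows "(\<integral>\<^sup>+y. w y \<partial>M) < \<infinity>"
proof (cases "c = 0")
  case True
  then have "w y = 0" for y
    using assms(3)[of y] by simp
  then show ?thesis
    by simp
next
  case False
  then have inv: "ennreal (inverse c) * ennreal c = 1"
    using assms(2) by (simp flip: ennreal_mult)
  have "ennreal (inverse c) * w y \<le> G y" for y
    using mult_left_mono[OF assms(3)[of y], of "ennreal (inverse c)"]
    by (simp add: inv mult.assoc[symmetric])
  then have "(\<integral>\<^sup>+y. ennreal (inverse c) * w y \<partial>M) \<le> (\<integral>\<^sup>+y. G y \<partial>M)"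
    by (rule nn_integral_mono)
  then have "ennreal (inverse c) * (\<integral>\<^sup>+y. w y \<partial>M) < \<infinity>"
    using assms(1,4) by (simp add: nn_integral_cmult)
  then show ?thesis
    using False assms(2) by (auto simp: ennreal_mult_less_top)
qed

text \<open>The constant in all estimates for \<open>T\<^sub>f\<close>: the absolute double integral with the weight \<open>decay\<close>
  in place of both Schwartz functions.\<close>

definition hausdorff_mass ::
    "(real^'n::finite \<Rightarrow> complex) \<Rightarrow> (real^'n \<Rightarrow> real^'d^'d::finite) \<Rightarrow> ennreal" where
  "hausdorff_mass \<Phi> A =
     (\<integral>\<^sup>+(x, y). ennreal (norm (\<Phi> y) * decay (A y *v x) * decay x) \<partial>(lebesgue \<Otimes>\<^sub>M lebesgue))"

lemma hausdorff_mass_finite: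
  fixes \<Phi> :: "real^'n::finite \<Rightarrow> complex" and A :: "real^'n \<Rightarrow> real^'d^'d::finite"
  assumes \<Phi>: "\<Phi> \<in> borel_measurable lebesgue" and A: "A \<in> borel_measurable lebesgue"
    and sv: "\<And>y. lists_singular_values (A y) (s y)" "\<And>y j. 0 < s y j"
    and fin: "(\<integral>\<^sup>+y. ennreal (norm (\<Phi> y) * (\<Prod>j\<in>UNIV. min 1 (inverse (s y j)))) \<partial>lebesgue) < \<infinity>"
  shows "hausdorff_mass \<Phi> A < \<infinity>"
proof -
  note kernel = nn_integral_hausdorff_kernel[OF \<Phi> A borel_measurable_decay less_imp_le[OF decay_pos]]
  show ?thesis
    unfolding hausdorff_mass_def kernel(2)
  proof (rule nn_integral_finite_dominated[OF kernel(1) _ _ fin])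
    fix y
    let ?P = "\<Prod>j\<in>UNIV. min 1 (inverse (s y j))"
    have P: "0 \<le> ?P"
      using sv(2) by (intro prod_nonneg) (auto simp: less_imp_le)
    have "ennreal (norm (\<Phi> y)) * (\<integral>\<^sup>+x. ennreal (decay (A y *v x) * decay x) \<partial>lborel)
        \<le> ennreal (norm (\<Phi> y)) * ennreal (pi ^ CARD('d) * ?P)"
      using sv by (intro mult_left_mono decay_kernel_le) auto
    also have "\<dots> = ennreal (pi ^ CARD('d)) * ennreal (norm (\<Phi> y) * ?P)"
      using P by (simp add: ac_simps flip: ennreal_mult)
    finally show "ennreal (norm (\<Phi> y)) * (\<integral>\<^sup>+x. ennreal (decay (A y *v x) * decay x) \<partial>lborel)
        \<le> ennreal (pi ^ CARD('d)) * ennreal (norm (\<Phi> y) * ?P)" .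
  qed simp
qed

lemma hausdorff_operator_eq_integral_pair:
  assumes "integrable (lebesgue \<Otimes>\<^sub>M lebesgue) (\<lambda>(x, y). \<Phi> y * f (A y *v x) * cnj (g x))"
  shows "hausdorff_operator \<Phi> A f g =
    (\<integral>(x, y). \<Phi> y * f (A y *v x) * cnj (g x) \<partial>(lebesgue \<Otimes>\<^sub>M lebesgue))"
  using lebesgue_pair.integral_fst'[OF assms] by (simp add: hausdorff_operator_def)

lemma hausdorff_integrable_and_bound:
  fixes \<Phi> :: "real^'n::finite \<Rightarrow> complex" and A :: "real^'n \<Rightarrow> real^'d^'d::finite"
  assumes \<Phi>: "\<Phi> \<in> borel_measurable lebesgue" and A: "A \<in> borel_measurable lebesgue"
    and fin: "hausdorff_mass \<Phi> A < \<infinity>"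
    and f: "f \<in> borel_measurable borel" "\<And>x. norm (f x) \<le> a * decay x"
    and g: "g \<in> borel_measurable borel" "\<And>x. norm (g x) \<le> b * decay x"
  shows "integrable (lebesgue \<Otimes>\<^sub>M lebesgue) (\<lambda>(x, y). \<Phi> y * f (A y *v x) * cnj (g x))"
    and "norm (hausdorff_operator \<Phi> A f g) \<le> a * b * enn2real (hausdorff_mass \<Phi> A)"
proof -
  let ?M = "(lebesgue :: (real^'d) measure) \<Otimes>\<^sub>M (lebesgue :: (real^'n) measure)"
  let ?F = "\<lambda>(x, y). \<Phi> y * f (A y *v x) * cnj (g x)"
  let ?W = "\<lambda>(x, y). norm (\<Phi> y) * decay (A y *v x) * decay x"
  have W: "?W \<in> borel_measurable ?M"
    using \<Phi> A by (intro hausdorff_integrand_measurable) auto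
  have W0: "0 \<le> ?W p" for p
    by (simp add: case_prod_beta less_imp_le[OF decay_pos])
  have mass: "(\<integral>\<^sup>+p. ennreal (?W p) \<partial>?M) = hausdorff_mass \<Phi> A"
    by (simp add: hausdorff_mass_def case_prod_beta')
  have int_W: "integrable ?M ?W"
    using W W0 mass fin by (intro integrableI_nonneg) auto
  have "(\<lambda>x. cnj (g x)) \<in> borel_measurable borel"
    by (rule measurable_compose[OF g(1)]) (intro borel_measurable_continuous_onI continuous_intros)
  then have F: "?F \<in> borel_measurable ?M"
    using \<Phi> A f(1) by (intro hausdorff_integrand_measurable) auto
  have le: "norm (?F p) \<le> a * b * ?W p" for p
  proof -
    obtain x y where p: "p = (x, y)"
      by (cases p)
    \<comment> \<open>\<open>a * decay\<close> is nonnegative because it bounds a norm.\<close>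
    have "norm (f (A y *v x)) * norm (g x) \<le> (a * decay (A y *v x)) * (b * decay x)"
      by (intro mult_mono f(2) g(2)) (use order_trans[OF norm_ge_zero f(2)] in auto)
    from mult_left_mono[OF this norm_ge_zero[of "\<Phi> y"]] show ?thesis
      by (simp add: p norm_mult ac_simps)
  qed
  show int_F: "integrable ?M ?F"
    by (rule Bochner_Integration.integrable_bound[OF integrable_mult_right[OF int_W, of "a * b"] F])
      (intro AE_I2, simp only: real_norm_def, rule order_trans[OF le abs_ge_self])
  have "hausdorff_operator \<Phi> A f g = integral\<^sup>L ?M ?F"
    by (rule hausdorff_operator_eq_integral_pair[OF int_F])
  also have "norm \<dots> \<le> (\<integral>p. norm (?F p) \<partial>?M)"
    by (rule integral_norm_bound)
  also have "\<dots> \<le> (\<integral>p. a * b * ?W p \<partial>?M)"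
    by (intro integral_mono integrable_norm int_F integrable_mult_right int_W le)
  also have "\<dots> = a * b * enn2real (hausdorff_mass \<Phi> A)"
    using W W0 by (simp add: integral_eq_nn_integral mass)
  finally show "norm (hausdorff_operator \<Phi> A f g) \<le> a * b * enn2real (hausdorff_mass \<Phi> A)" .
qed

lemma hausdorff_operator_combination:
  assumes g: "integrable (lebesgue \<Otimes>\<^sub>M lebesgue) (\<lambda>(x, y). \<Phi> y * f (A y *v x) * cnj (g x))"
    and h: "integrable (lebesgue \<Otimes>\<^sub>M lebesgue) (\<lambda>(x, y). \<Phi> y * f (A y *v x) * cnj (h x))"
  shows "hausdorff_operator \<Phi> A f (\<lambda>x. b * g x + c * h x) =
    cnj b * hausdorff_operator \<Phi> A f g + cnj c * hausdorff_operator \<Phi> A f h"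
proof -
  let ?F = "\<lambda>g (x, y). \<Phi> y * f (A y *v x) * cnj (g x)"
  let ?M = "lebesgue \<Otimes>\<^sub>M lebesgue"
  have eq: "?F (\<lambda>x. b * g x + c * h x) = (\<lambda>p. cnj b * ?F g p + cnj c * ?F h p)"
    by (auto simp: fun_eq_iff algebra_simps)
  have int: "integrable ?M (?F (\<lambda>x. b * g x + c * h x))"
    unfolding eq using g h by (intro Bochner_Integration.integrable_add integrable_mult_right)
  have "integral\<^sup>L ?M (?F (\<lambda>x. b * g x + c * h x)) = cnj b * integral\<^sup>L ?M (?F g) + cnj c * integral\<^sup>L ?M (?F h)"
    unfolding eq using g h by (simp add: Bochner_Integration.integral_add)
  then show ?thesis
    by (simp add: hausdorff_operator_eq_integral_pair[OF int] hausdorff_operator_eq_integral_pair[OF g]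
        hausdorff_operator_eq_integral_pair[OF h])
qed

text \<open>Once the mass is finite, the bound of \<open>g - h\<close> by \<open>decay\<close> times its seminorm turns into the
  seminorm estimate that continuity needs.\<close>

lemma hausdorff_operator_tempered:
  fixes \<Phi> :: "real^'n::finite \<Rightarrow> complex" and A :: "real^'n \<Rightarrow> real^'d^'d::finite"
  assumes \<Phi>: "\<Phi> \<in> borel_measurable lebesgue" and A: "A \<in> borel_measurable lebesgue"
    and fin: "hausdorff_mass \<Phi> A < \<infinity>" and f: "f \<in> schwartz"
  shows "hausdorff_well_defined \<Phi> A f" and "hausdorff_operator \<Phi> A f \<in> tempered_distributions"
proof -
  let ?u = "hausdorff_operator \<Phi> A f"
  have f': "f \<in> borel_measurable borel" "norm (f x) \<le> decay_seminorm f * decay x" for x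
    using f by (auto intro: schwartz_measurable norm_le_decay_seminorm schwartz_bounded)
  note estimate = hausdorff_integrable_and_bound[OF \<Phi> A fin f']
  have int: "integrable (lebesgue \<Otimes>\<^sub>M lebesgue) (\<lambda>(x, y). \<Phi> y * f (A y *v x) * cnj (g x))"
    if "g \<in> schwartz" for g
    using that
    by (intro estimate(1)[where b = "decay_seminorm g"])
      (auto intro: schwartz_measurable norm_le_decay_seminorm schwartz_bounded)
  then show "hausdorff_well_defined \<Phi> A f"
    by (simp add: hausdorff_well_defined_def)
  define C where "C = decay_seminorm f * enn2real (hausdorff_mass \<Phi> A) * (2 * real CARD('d)) ^ CARD('d)"
  have "continuous_map schwartz_topology euclidean ?u"
  proof (rule continuous_map_schwartz_topology[where K = UNIV and \<alpha> = decay_index and \<beta> = "\<lambda>_. []" and C = C])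
    have "0 \<le> decay_seminorm f * decay (0 :: real^'d)"
      by (rule order_trans[OF norm_ge_zero f'(2)])
    then show "0 \<le> C"
      using decay_pos[of "0::real^'d"] by (simp add: C_def zero_le_mult_iff)
    fix g h :: "real^'d \<Rightarrow> complex" assume gh: "g \<in> schwartz" "h \<in> schwartz"
    have "?u g - ?u h = ?u (\<lambda>x. g x - h x)"
      using hausdorff_operator_combination[OF int[OF gh(1)] int[OF gh(2)], of 1 "- 1"] by simp
    also have "norm \<dots> \<le> decay_seminorm f * decay_seminorm (\<lambda>x. g x - h x) * enn2real (hausdorff_mass \<Phi> A)"
      using gh
      by (intro estimate(2)) (auto intro: borel_measurable_diff schwartz_measurable norm_le_decay_seminorm
          bounded_weighted_diff)
    also have "\<dots> = C * (\<Sum>k\<in>UNIV. schwartz_seminorm (decay_index k) [] (\<lambda>x. g x - h x))"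
      by (simp add: C_def decay_seminorm_def[of "\<lambda>x. g x - h x"])
    finally show "norm (?u g - ?u h) \<le> C * (\<Sum>k\<in>UNIV. schwartz_seminorm (decay_index k) [] (\<lambda>x. g x - h x))" .
  qed simp
  moreover have "?u (\<lambda>x. g x + h x) = ?u g + ?u h" if "g \<in> schwartz" "h \<in> schwartz" for g h
    using hausdorff_operator_combination[OF int[OF that(1)] int[OF that(2)], of 1 1] by simp
  moreover have "?u (\<lambda>x. c * g x) = cnj c * ?u g" if "g \<in> schwartz" for c g
    using hausdorff_operator_combination[OF int[OF that] int[OF that], of c 0] by simp
  ultimately show "?u \<in> tempered_distributions"
    by (simp add: tempered_distributions_def)
qed

text \<open>One test pair suffices: with the Gaussian in both places the integrand has absolute value
  \<open>\<bar>\<Phi>\<bar>\<close> times a positive weight, and the kernel of this weight is at least a positive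
  constant times the product in the condition.\<close>

lemma hausdorff_condition_necessary:
  fixes \<Phi> :: "real^'n::finite \<Rightarrow> complex" and A :: "real^'n \<Rightarrow> real^'d^'d::finite"
  assumes \<Phi>: "\<Phi> \<in> borel_measurable lebesgue" and A: "A \<in> borel_measurable lebesgue"
    and sv: "\<And>y. lists_singular_values (A y) (s y)" "\<And>y j. 0 < s y j"
    and wd: "hausdorff_well_defined \<Phi> A (\<lambda>x. complex_of_real (gaussian x))"
  shows "(\<integral>\<^sup>+y. ennreal (norm (\<Phi> y) * (\<Prod>j\<in>UNIV. min 1 (inverse (s y j)))) \<partial>lebesgue) < \<infinity>"
proof -
  let ?c = "exp (- 2) ^ CARD('d) :: real"
  let ?w = "\<lambda>y. ennreal (norm (\<Phi> y)) * (\<integral>\<^sup>+x. ennreal (gaussian (A y *v x) * gaussian x) \<partial>lborel)"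
  have gaussian: "(gaussian :: real^'d \<Rightarrow> real) \<in> borel_measurable borel" "\<And>x::real^'d. 0 \<le> gaussian x"
    by (auto simp: gaussian_def[abs_def])
  note kernel = nn_integral_hausdorff_kernel[OF \<Phi> A gaussian]
  have "integrable (lebesgue \<Otimes>\<^sub>M lebesgue)
      (\<lambda>(x, y). \<Phi> y * complex_of_real (gaussian (A y *v x)) * cnj (complex_of_real (gaussian x)))"
    using wd[unfolded hausdorff_well_defined_def] gaussian_in_schwartz by (rule bspec)
  then have "(\<integral>\<^sup>+(x, y). ennreal (norm (\<Phi> y) * gaussian (A y *v x) * gaussian x)
      \<partial>(lebesgue \<Otimes>\<^sub>M lebesgue)) < \<infinity>"
    using gaussian(2) by (simp add: integrable_iff_bounded case_prod_beta' norm_mult)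
  then have fin: "(\<integral>\<^sup>+y. ?w y \<partial>lebesgue) < \<infinity>"
    by (simp only: kernel(2))
  have "ennreal (norm (\<Phi> y) * (\<Prod>j\<in>UNIV. min 1 (inverse (s y j)))) \<le> ennreal (inverse ?c) * ?w y" for y
  proof -
    let ?P = "\<Prod>j\<in>UNIV. min 1 (inverse (s y j))"
    have P: "0 \<le> ?P"
      using sv(2) by (intro prod_nonneg) (auto simp: less_imp_le)
    have "ennreal (norm (\<Phi> y) * ?P) = ennreal (inverse ?c) * (ennreal (norm (\<Phi> y)) * ennreal (?c * ?P))"
      using P by (simp flip: ennreal_mult)
    also have "\<dots> \<le> ennreal (inverse ?c) * ?w y"
      using sv by (intro mult_left_mono gaussian_kernel_ge) auto
    finally show ?thesis .
  qed
  then have "(\<integral>\<^sup>+y. ennreal (norm (\<Phi> y) * (\<Prod>j\<in>UNIV. min 1 (inverse (s y j)))) \<partial>lebesgue)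
      \<le> (\<integral>\<^sup>+y. ennreal (inverse ?c) * ?w y \<partial>lebesgue)"
    by (rule nn_integral_mono)
  also have "\<dots> = ennreal (inverse ?c) * (\<integral>\<^sup>+y. ?w y \<partial>lebesgue)"
    by (rule nn_integral_cmult[OF kernel(1)])
  also have "\<dots> < \<infinity>"
    using fin by (simp add: ennreal_mult_less_top)
  finally show ?thesis .
qed

theorem theorem4p1:
  fixes \<Phi> :: "real^'n::finite \<Rightarrow> complex"
    and A :: "real^'n \<Rightarrow> real^'d^'d::finite"
    and s :: "real^'n \<Rightarrow> 'd \<Rightarrow> real"
  assumes "\<Phi> \<in> borel_measurable lebesgue"
    and "A \<in> borel_measurable lebesgue"
    and "\<And>y. invertible (A y)"
    and "\<And>y. lists_singular_values (A y) (s y)"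
  shows "((\<integral>\<^sup>+y. ennreal (norm (\<Phi> y) * (\<Prod>j\<in>UNIV. min 1 (inverse (s y j)))) \<partial>lebesgue) < \<infinity> \<longrightarrow>
            (\<forall>f\<in>schwartz. hausdorff_well_defined \<Phi> A f) \<and>
            hausdorff_operator \<Phi> A \<in> schwartz \<rightarrow> tempered_distributions) \<and>
         ((\<forall>y. \<Phi> y \<in> \<real>\<^sub>\<ge>\<^sub>0) \<and>
          (\<forall>f\<in>schwartz. hausdorff_well_defined \<Phi> A f \<and>
                          hausdorff_operator \<Phi> A f \<in> tempered_distributions) \<longrightarrow>
            (\<integral>\<^sup>+y. ennreal (norm (\<Phi> y) * (\<Prod>j\<in>UNIV. min 1 (inverse (s y j)))) \<partial>lebesgue) < \<infinity>)"
proof -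
  have pos: "0 < s y j" for y j
    using singular_values_invertible_pos[OF assms(4,3)] .
  note mass = hausdorff_mass_finite[OF assms(1,2,4) pos]
  note necessary = hausdorff_condition_necessary[OF assms(1,2,4) pos]
  show ?thesis
    using hausdorff_operator_tempered[OF assms(1,2) mass] necessary gaussian_in_schwartz
    by blast
qed

end
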